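(* There is no first-order sentence $\varphi$ over the vocabulary $\{D\}$ ($D$ a ternary relation symbol) such that for every $W$-structure $(X,D)$ of a finite simple connected graph $G$, $(X,D)$ satisfies $\varphi$ if and only if $G$ is bipartite. That is, bipartite graphs cannot be defined by a first-order formula over $W$-structures.
   Context: In a finite simple graph $G$, a walk $W=w_1w_2\cdots w_k$ ($k\ge 2$) is a toll walk if $w_1\neq w_k$, $w_2$ is the only neighbor of $w_1$ among the vertices of $W$, and $w_{k-1}$ is the only neighbor of $w_k$ among the vertices of $W$. The toll walk transit function $T$ of $G$ is given by $T(u,u)=\{u\}$ and, for $u\ne v$, $T(u,v)$ is the set of all vertices lying on some toll walk from $u$ to $v$. The $W$-structure of $G$ is the ternary structure $(V(G),D)$ with $D(x,y,z)$ iff $y\in T(x,z)$. *)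

theory Defs
  imports "Graph_Theory.Graph_Theory"
begin

text \<open>
  Finite simple graphs are the \<^locale>\<open>pair_graph\<close>s: finite, loopless digraphs without parallel
  arcs whose arc relation is symmetric. Both \<^const>\<open>connected\<close> and \<^const>\<open>vwalk\<close> are the
  library notions; a connected graph is in particular nonempty, and vertices may repeat in a walk.
\<close>

definition bipartite :: "'a pair_pre_digraph \<Rightarrow> bool" where
  "bipartite G \<longleftrightarrow> (\<exists>A B. A \<union> B = pverts G \<and> A \<inter> B = {} \<and>
     (\<forall>(u, v) \<in> parcs G. u \<in> A \<and> v \<in> B \<or> u \<in> B \<and> v \<in> A))"

text \<open>
  A walk \<open>w\<^sub>1 \<dots> w\<^sub>k\<close> is the list \<open>p\<close>; as lists are indexed from 0, \<open>w\<^sub>2\<close> is \<open>p ! 1\<close> and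
  \<open>w\<^sub>k\<^sub>-\<^sub>1\<close> is \<open>p ! (length p - 2)\<close>.
\<close>

definition toll_walk :: "'a pair_pre_digraph \<Rightarrow> 'a list \<Rightarrow> bool" where
  "toll_walk G p \<longleftrightarrow> vwalk p (with_proj G) \<and> 2 \<le> length p \<and> hd p \<noteq> last p \<and>
     {x \<in> set p. (hd p, x) \<in> parcs G} = {p ! 1} \<and>
     {x \<in> set p. (last p, x) \<in> parcs G} = {p ! (length p - 2)}"

definition toll_transit :: "'a pair_pre_digraph \<Rightarrow> 'a \<Rightarrow> 'a \<Rightarrow> 'a set" where
  "toll_transit G u v =
     (if u = v then {u}
      else {x. \<exists>p. toll_walk G p \<and> hd p = u \<and> last p = v \<and> x \<in> set p})"

type_synonym 'a ternary_structure = "'a set \<times> ('a \<times> 'a \<times> 'a) set"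

definition W_structure :: "'a pair_pre_digraph \<Rightarrow> 'a ternary_structure" where
  "W_structure G = (pverts G,
     {(x, y, z). x \<in> pverts G \<and> z \<in> pverts G \<and> y \<in> toll_transit G x z})"

text \<open>
  First-order logic with equality over one ternary relation symbol. Variables are natural numbers;
  the remaining connectives and the universal quantifier are expressible from those below.
\<close>

datatype fo =
    Eq nat nat
  | Rel nat nat nat
  | Neg fo
  | Conj fo fo
  | Exists nat fo

primrec free_vars :: "fo \<Rightarrow> nat set" where
  "free_vars (Eq i j) = {i, j}"
| "free_vars (Rel i j k) = {i, j, k}"
| "free_vars (Neg \<phi>) = free_vars \<phi>"
| "free_vars (Conj \<phi> \<psi>) = free_vars \<phi> \<union> free_vars \<psi>"
| "free_vars (Exists i \<phi>) = free_vars \<phi> - {i}"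

definition is_sentence :: "fo \<Rightarrow> bool" where
  "is_sentence \<phi> \<longleftrightarrow> free_vars \<phi> = {}"

primrec sat :: "'a ternary_structure \<Rightarrow> (nat \<Rightarrow> 'a) \<Rightarrow> fo \<Rightarrow> bool" where
  "sat M s (Eq i j) \<longleftrightarrow> s i = s j"
| "sat M s (Rel i j k) \<longleftrightarrow> (s i, s j, s k) \<in> snd M"
| "sat M s (Neg \<phi>) \<longleftrightarrow> \<not> sat M s \<phi>"
| "sat M s (Conj \<phi> \<psi>) \<longleftrightarrow> sat M s \<phi> \<and> sat M s \<psi>"
| "sat M s (Exists i \<phi>) \<longleftrightarrow> (\<exists>a \<in> fst M. sat M (s(i := a)) \<phi>)"

text \<open>
  For a sentence and a nonempty domain the choice of the assignment is immaterial.
\<close>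

definition satisfies :: "'a ternary_structure \<Rightarrow> fo \<Rightarrow> bool" (infix \<open>\<Turnstile>\<close> 50) where
  "M \<Turnstile> \<phi> \<longleftrightarrow> (\<forall>s. range s \<subseteq> fst M \<longrightarrow> sat M s \<phi>)"

end

theory Submission
  imports Defs
begin

text \<open>
  Even cycles are bipartite and odd cycles are not, but first-order logic cannot tell long cycles
  apart. In a cycle, \<open>T(u, v)\<close> is \<open>{u, v}\<close> for adjacent \<open>u, v\<close> and the whole vertex set for
  distinct non-adjacent ones, so the truth of an atom depends only on which of the
  variables have equal or adjacent values. In an Ehrenfeucht--Fraisse game with \<open>r\<close> rounds left,
  Duplicator keeps the signed offsets of absolute value at most \<open>2 ^ r\<close> between the chosen vertices
  the same in both cycles: a vertex at offset at most \<open>2 ^ r\<close> from a chosen one is answered by the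
  corresponding translate, any other one by a vertex far from everything chosen so far.
\<close>

section \<open>Formulas\<close>

primrec quantifier_rank :: "fo \<Rightarrow> nat" where
  "quantifier_rank (Eq i j) = 0"
| "quantifier_rank (Rel i j k) = 0"
| "quantifier_rank (Neg \<phi>) = quantifier_rank \<phi>"
| "quantifier_rank (Conj \<phi> \<psi>) = max (quantifier_rank \<phi>) (quantifier_rank \<psi>)"
| "quantifier_rank (Exists i \<phi>) = Suc (quantifier_rank \<phi>)"

text \<open>Strictly bounds every variable index in the formula, free or bound, so that the game
  only has to track the variables below a fixed \<open>N\<close>.\<close>

primrec width :: "fo \<Rightarrow> nat" where
  "width (Eq i j) = Suc (max i j)"
| "width (Rel i j k) = Suc (max i (max j k))"
| "width (Neg \<phi>) = width \<phi>"
| "width (Conj \<phi> \<psi>) = max (width \<phi>) (width \<psi>)"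
| "width (Exists i \<phi>) = max (Suc i) (width \<phi>)"

lemma sat_cong_free_vars:
  assumes "\<And>i. i \<in> free_vars \<phi> \<Longrightarrow> s i = t i"
  shows "sat M s \<phi> \<longleftrightarrow> sat M t \<phi>"
  using assms
proof (induction \<phi> arbitrary: s t)
  case (Neg \<phi>)
  show ?case using Neg.IH[of s t] Neg.prems by simp
next
  case (Conj \<phi> \<psi>)
  show ?case using Conj.IH(1)[of s t] Conj.IH(2)[of s t] Conj.prems by simp
next
  case (Exists i \<phi>)
  have "sat M (s(i := a)) \<phi> \<longleftrightarrow> sat M (t(i := a)) \<phi>" for a
    using Exists.prems by (intro Exists.IH) auto
  then show ?case by simp
qed simp_all

text \<open>One admissible \<open>s\<close> keeps the quantifier in \<open>\<Turnstile>\<close> from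
  being vacuous, and on a sentence all assignments agree.\<close>

lemma satisfies_sentence_iff:
  assumes "is_sentence \<phi>" "range s \<subseteq> fst M"
  shows "M \<Turnstile> \<phi> \<longleftrightarrow> sat M s \<phi>"
  unfolding satisfies_def using assms sat_cong_free_vars[of \<phi>]
  by (metis empty_iff is_sentence_def)

section \<open>Cycles\<close>

text \<open>A relation rather than a function, because the signed displacement from \<open>v\<close>
  to \<open>u\<close> is determined only modulo \<open>n\<close>.\<close>

definition offset :: "nat \<Rightarrow> nat \<Rightarrow> nat \<Rightarrow> int \<Rightarrow> bool" where
  "offset n u v d \<longleftrightarrow> int n dvd int u - int v - d"

text \<open>For \<open>n = 2\<close> the two congruences coincide and the graph is a single edge;
  from \<open>n = 3\<close> on it is the usual cycle.\<close>

definition cycle :: "nat \<Rightarrow> nat pair_pre_digraph" where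
  "cycle n = \<lparr>pverts = {..<n},
     parcs = {(u, v). u < n \<and> v < n \<and> (offset n u v 1 \<or> offset n u v (-1))}\<rparr>"

lemma pverts_cycle [simp]: "pverts (cycle n) = {..<n}"
  by (simp add: cycle_def)

lemma parcs_cycle_iff:
  "(u, v) \<in> parcs (cycle n) \<longleftrightarrow> u < n \<and> v < n \<and> (offset n u v 1 \<or> offset n u v (-1))"
  by (simp add: cycle_def)

lemma dvd_imp_eq_0:
  fixes x :: int
  assumes "int n dvd x" "\<bar>x\<bar> < int n"
  shows "x = 0"
  using assms zdvd_imp_le[of "int n" "\<bar>x\<bar>"] by (cases "x = 0") auto

lemma offset_sym: "offset n v u d \<longleftrightarrow> offset n u v (- d)"
proof -
  have "int v - int u - d = - (int u - int v - - d)" by simp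
  then show ?thesis unfolding offset_def by (metis dvd_minus_iff)
qed

text \<open>Displacements add along the cycle. A translated reply of Duplicator thus gets all its
  offsets from those of the vertex it is translated from.\<close>

lemma offset_shift:
  assumes "offset n u v d"
  shows "offset n u w e \<longleftrightarrow> offset n v w (e - d)"
proof -
  have "int u - int w - e = (int u - int v - d) + (int v - int w - (e - d))" by simp
  then show ?thesis using assms unfolding offset_def by (metis dvd_add_right_iff)
qed

lemma offset_self_iff:
  assumes "\<bar>d\<bar> < int n"
  shows "offset n u u d \<longleftrightarrow> d = 0"
  using assms dvd_imp_eq_0[of n d] by (auto simp: offset_def)

lemma offset_0_iff:
  assumes "u < n" "v < n"
  shows "offset n u v 0 \<longleftrightarrow> u = v"
  using assms dvd_imp_eq_0[of n "int u - int v"] by (auto simp: offset_def)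

definition translate :: "nat \<Rightarrow> nat \<Rightarrow> int \<Rightarrow> nat" where
  "translate n u d = nat ((int u + d) mod int n)"

lemma translate_less: "0 < n \<Longrightarrow> translate n u d < n"
  by (simp add: translate_def nat_less_iff)

lemma offset_iff_translate:
  assumes "u < n"
  shows "offset n u v d \<longleftrightarrow> u = translate n v d"
proof -
  have "offset n u v d \<longleftrightarrow> int u mod int n = (int v + d) mod int n"
    by (simp add: offset_def mod_eq_dvd_iff diff_diff_eq)
  also have "\<dots> \<longleftrightarrow> u = translate n v d"
    using assms by (auto simp: translate_def nat_eq_iff)
  finally show ?thesis .
qed

section \<open>The cycle graphs: simplicity, connectedness and bipartiteness\<close>

lemma parcs_cycle_sym: "(u, v) \<in> parcs (cycle n) \<longleftrightarrow> (v, u) \<in> parcs (cycle n)"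
  by (auto simp: parcs_cycle_iff offset_sym[of n v u])

lemma pair_graph_cycle:
  assumes "2 \<le> n"
  shows "pair_graph (cycle n)"
proof
  show "finite (parcs (cycle n))"
    by (rule finite_subset[of _ "{..<n} \<times> {..<n}"]) (auto simp: parcs_cycle_iff)
  show "fst e \<noteq> snd e" if "e \<in> parcs (cycle n)" for e
  proof
    assume "fst e = snd e"
    then have "(fst e, fst e) \<in> parcs (cycle n)" using that by (metis prod.collapse)
    then show False using assms by (auto simp: parcs_cycle_iff offset_self_iff)
  qed
  show "symmetric (with_proj (cycle n))"
    unfolding symmetric_def with_proj_simps by (rule symI) (simp only: parcs_cycle_sym)
qed (auto simp: parcs_cycle_iff)

lemma parcs_cycle_Suc: "Suc u < n \<Longrightarrow> (u, Suc u) \<in> parcs (cycle n)"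
  by (simp add: parcs_cycle_iff offset_def)

lemma connected_cycle:
  assumes "0 < n"
  shows "connected (with_proj (cycle n))"
proof -
  let ?R = "rtrancl_on {..<n} ((parcs (cycle n))\<^sup>s)"
  have up: "(u, v) \<in> ?R" if "u \<le> v" "v < n" for u v
    using that
  proof (induction v rule: dec_induct)
    case (step k)
    then have "(k, Suc k) \<in> (parcs (cycle n))\<^sup>s"
      using parcs_cycle_Suc[of k n] by (simp add: symcl_def)
    with step show ?case by (auto intro: rtrancl_on_into_rtrancl_on)
  qed auto
  have down: "(v, u) \<in> ?R" if "u \<le> v" "v < n" for u v
    using that
  proof (induction v rule: dec_induct)
    case (step k)
    then have "(Suc k, k) \<in> (parcs (cycle n))\<^sup>s"
      using parcs_cycle_Suc[of k n] parcs_cycle_sym[of k "Suc k" n] by (simp add: symcl_def)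
    with step show ?case by (auto intro: converse_rtrancl_on_into_rtrancl_on)
  qed auto
  have "(u, v) \<in> ?R" if "u < n" "v < n" for u v
    using up[of u v] down[of v u] that by linarith
  then show ?thesis
    using assms by (auto simp: connected_conv)
qed

lemma bipartite_cycle:
  assumes "even n"
  shows "bipartite (cycle n)"
proof -
  let ?A = "{u. u < n \<and> even u}" and ?B = "{u. u < n \<and> odd u}"
  have arc: "u \<in> ?A \<and> v \<in> ?B \<or> u \<in> ?B \<and> v \<in> ?A" if "(u, v) \<in> parcs (cycle n)" for u v
  proof -
    have "2 dvd int n" using assms by simp
    \<comment> \<open>For even \<open>n\<close> a congruence modulo \<open>n\<close> passes to one
      modulo 2, so neighbours have opposite parity.\<close>
    then have "2 dvd int u - int v - 1 \<or> 2 dvd int u - int v - (-1)"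
      using that unfolding parcs_cycle_iff offset_def by (blast intro: dvd_trans)
    then have "even u \<longleftrightarrow> odd v" by presburger
    then show ?thesis using that by (auto simp: parcs_cycle_iff)
  qed
  have "?A \<union> ?B = pverts (cycle n)" "?A \<inter> ?B = {}" by auto
  with arc show ?thesis unfolding bipartite_def by blast
qed

text \<open>Membership in \<open>A\<close> alternates along the path from \<open>0\<close> to
  \<open>n - 1\<close>. Both ends have even labels, yet the closing arc joins them.\<close>

lemma not_bipartite_cycle:
  assumes "odd n"
  shows "\<not> bipartite (cycle n)"
proof
  assume "bipartite (cycle n)"
  then obtain A B where disj: "A \<inter> B = {}"
    and arcs: "\<forall>(u, v) \<in> parcs (cycle n). u \<in> A \<and> v \<in> B \<or> u \<in> B \<and> v \<in> A"
    unfolding bipartite_def by (elim exE conjE)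
  have flip: "v \<in> A \<longleftrightarrow> u \<notin> A" if "(u, v) \<in> parcs (cycle n)" for u v
    using bspec[OF arcs that] disj by auto
  have parity: "u \<in> A \<longleftrightarrow> (even u \<longleftrightarrow> 0 \<in> A)" if "u < n" for u
    using that
  proof (induction u)
    case (Suc u)
    then show ?case using flip[OF parcs_cycle_Suc[of u n]] by auto
  qed simp
  have "(n - 1, 0) \<in> parcs (cycle n)"
    using odd_pos[OF assms] by (simp add: parcs_cycle_iff offset_def of_nat_diff)
  from flip[OF this] parity[of "n - 1"] odd_pos[OF assms] assms show False by simp
qed

section \<open>Toll walks in cycles\<close>

lemma vwalk_arcs_eq_zip: "vwalk_arcs p = zip p (tl p)"
  by (induction p rule: vwalk_arcs.induct) auto

lemma set_vwalk_arcs: "set (vwalk_arcs p) = {(p ! i, p ! Suc i) | i. Suc i < length p}"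
  by (force simp: vwalk_arcs_eq_zip set_zip nth_tl)

text \<open>Both ends lie on the walk, so each is the only neighbour that the toll condition grants
  the other. A walk starting at \<open>u\<close> can then only alternate between the two.\<close>

lemma toll_transit_adjacent:
  assumes G: "pair_graph G" and uv: "(u, v) \<in> parcs G"
  shows "toll_transit G u v = {u, v}"
proof -
  interpret pair_graph G by fact
  have vu: "(v, u) \<in> parcs G" using uv arcs_symmetric by blast
  have ne: "u \<noteq> v" using uv pair_no_loops by fastforce
  have loops: "(u, u) \<notin> parcs G" "(v, v) \<notin> parcs G" using pair_no_loops by fastforce+
  have "set p \<subseteq> {u, v}" if p: "toll_walk G p" "hd p = u" "last p = v" for p
  proof -
    from p(1) have "p \<noteq> []" by (auto simp: toll_walk_def)
    then have mem: "u \<in> set p" "v \<in> set p" using p by auto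
    have start: "{x \<in> set p. (u, x) \<in> parcs G} = {p ! 1}"
      and finish: "{x \<in> set p. (v, x) \<in> parcs G} = {p ! (length p - 2)}"
      using p(1) unfolding toll_walk_def p(2,3) by blast+
    have nbrs: "x = v" if "(u, x) \<in> parcs G" "x \<in> set p" for x
    proof -
      have "x \<in> {p ! 1}" "v \<in> {p ! 1}" unfolding start[symmetric] using that mem uv by simp_all
      then show ?thesis by simp
    qed
    have nbrs': "x = u" if "(v, x) \<in> parcs G" "x \<in> set p" for x
    proof -
      have "x \<in> {p ! (length p - 2)}" "u \<in> {p ! (length p - 2)}"
        unfolding finish[symmetric] using that mem vu by simp_all
      then show ?thesis by simp
    qed
    have "p ! i \<in> {u, v}" if "i < length p" for i
      using that
    proof (induction i)
      case 0
      then show ?case using p \<open>p \<noteq> []\<close> by (simp add: hd_conv_nth)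
    next
      case (Suc i)
      have "(p ! i, p ! Suc i) \<in> parcs G"
        using p(1) Suc.prems by (auto simp: toll_walk_def vwalk_def set_vwalk_arcs)
      then show ?case using Suc nbrs nbrs' by auto
    qed
    then show ?thesis by (metis in_set_conv_nth subsetI)
  qed
  moreover have "toll_walk G [u, v]"
    using uv vu ne loops by (auto simp: toll_walk_def vwalk_def intro: in_arcsD1 in_arcsD2)
  then have "{u, v} \<subseteq> {x. \<exists>p. toll_walk G p \<and> hd p = u \<and> last p = v \<and> x \<in> set p}"
    using ne by (auto intro!: exI[of _ "[u, v]"])
  ultimately show ?thesis
    unfolding toll_transit_def using ne by auto
qed

section \<open>Toll walks along the arcs of a cycle\<close>

definition arc_walk :: "nat \<Rightarrow> nat \<Rightarrow> int \<Rightarrow> nat \<Rightarrow> nat list" where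
  "arc_walk n u \<sigma> k = map (\<lambda>i. translate n u (\<sigma> * int i)) [0..<Suc k]"

text \<open>Reversing the direction \<open>\<sigma>\<close> merely exchanges the two congruences, so
  only the difference of the indices matters.\<close>

lemma parcs_cycle_translate_iff:
  assumes "\<sigma> \<in> {1, -1}" "0 < n"
  shows "(translate n u (\<sigma> * int i), translate n u (\<sigma> * int j)) \<in> parcs (cycle n) \<longleftrightarrow>
    int n dvd int i - int j - 1 \<or> int n dvd int i - int j + 1"
proof -
  let ?a = "translate n u (\<sigma> * int i)" and ?b = "translate n u (\<sigma> * int j)"
  have "offset n ?a u (\<sigma> * int i)" "offset n ?b u (\<sigma> * int j)"
    using offset_iff_translate translate_less[OF assms(2)] by blast+
  then have "offset n ?a ?b d \<longleftrightarrow> int n dvd \<sigma> * int i - \<sigma> * int j - d" for d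
  proof -
    assume a: "offset n ?a u (\<sigma> * int i)" and b: "offset n ?b u (\<sigma> * int j)"
    have "offset n ?a ?b d \<longleftrightarrow> offset n ?b u (\<sigma> * int i - d)"
      using offset_shift[OF a, of ?b d] offset_sym[of n ?b u "\<sigma> * int i - d"] by simp
    also have "\<dots> \<longleftrightarrow> int n dvd \<sigma> * int i - \<sigma> * int j - d"
      using offset_shift[OF b, of u "\<sigma> * int i - d"]
        dvd_minus_iff[of "int n" "\<sigma> * int i - \<sigma> * int j - d"]
      by (simp add: offset_def algebra_simps)
    finally show ?thesis .
  qed
  moreover have "int n dvd - int i + int j - 1 \<longleftrightarrow> int n dvd int i - int j + 1"
    "int n dvd - int i + int j + 1 \<longleftrightarrow> int n dvd int i - int j - 1"
    using dvd_minus_iff[of "int n" "int i - int j + 1"]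
      dvd_minus_iff[of "int n" "int i - int j - 1"] by (simp_all add: algebra_simps)
  ultimately show ?thesis
    using assms translate_less[OF assms(2)] by (auto simp: parcs_cycle_iff)
qed

text \<open>An arc of \<open>k\<close> steps has \<open>k + 1\<close> vertices and so misses at
  least one vertex of the cycle. Hence it is an induced path, and each end has just one neighbour on
  it.\<close>

lemma toll_walk_arc_walk:
  assumes \<sigma>: "\<sigma> \<in> {1, -1}" and k: "1 \<le> k" "k + 2 \<le> n"
  shows "toll_walk (cycle n) (arc_walk n u \<sigma> k)"
proof -
  define w where "w i = translate n u (\<sigma> * int i)" for i
  let ?p = "arc_walk n u \<sigma> k"
  have n: "0 < n" using k by simp
  have adj: "(w i, w j) \<in> parcs (cycle n) \<longleftrightarrow>
      int n dvd int i - int j - 1 \<or> int n dvd int i - int j + 1" for i j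
    unfolding w_def using parcs_cycle_translate_iff[OF \<sigma> n] .
  have len: "length ?p = Suc k" by (simp add: arc_walk_def)
  have nth: "?p ! i = w i" if "i \<le> k" for i
    using that by (simp add: arc_walk_def w_def del: upt_Suc)
  have set: "set ?p = w ` {..k}"
    by (simp add: arc_walk_def w_def atLeastLessThanSuc_atLeastAtMost atLeast0AtMost del: upt_Suc)
  have ne: "?p \<noteq> []" using len by auto
  have hd: "hd ?p = w 0" using nth[of 0] ne by (simp add: hd_conv_nth)
  have last: "last ?p = w k" using nth[of k] ne len by (simp add: last_conv_nth)
  \<comment> \<open>Index differences shifted by one stay below \<open>n\<close> in absolute value,
    so the congruences become equations, here and for \<open>finish\<close>.\<close>
  have start: "(w 0, w i) \<in> parcs (cycle n) \<longleftrightarrow> i = 1" if "i \<le> k" for i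
    using that k dvd_imp_eq_0[of n "- int i - 1"] dvd_imp_eq_0[of n "- int i + 1"]
    by (auto simp: adj)
  have finish: "(w k, w i) \<in> parcs (cycle n) \<longleftrightarrow> i = k - 1" if "i \<le> k" for i
  proof -
    have "\<bar>int k - int i - 1\<bar> < int n" "\<bar>int k - int i + 1\<bar> < int n" using that k by linarith+
    then show ?thesis
      using that k dvd_imp_eq_0[of n "int k - int i - 1"] dvd_imp_eq_0[of n "int k - int i + 1"]
      by (auto simp: adj of_nat_diff)
  qed
  have step: "(w i, w (Suc i)) \<in> parcs (cycle n)" for i
    by (simp add: adj)
  have "offset n (w i) u (\<sigma> * int i)" for i
    unfolding w_def using offset_iff_translate translate_less[OF n] by blast
  \<comment> \<open>If the ends coincided, \<open>u\<close> would have offset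
    \<open>\<sigma> * int k\<close> to itself, which is nonzero and below \<open>n\<close> in
    absolute value.\<close>
  from offset_shift[OF this[of 0], of u "\<sigma> * int k"] this[of k]
  have "w 0 \<noteq> w k"
    using offset_self_iff[of "\<sigma> * int k" n u] \<sigma> k by auto
  moreover have "vwalk ?p (with_proj (cycle n))"
  proof -
    have "set (vwalk_arcs ?p) \<subseteq> parcs (cycle n)"
      using step by (auto simp: set_vwalk_arcs len nth)
    then show ?thesis
      using ne set translate_less[OF n] by (auto simp: vwalk_def w_def)
  qed
  moreover have "{x \<in> set ?p. (w 0, x) \<in> parcs (cycle n)} = {w 1}"
    using k by (auto simp: set start)
  moreover have "{x \<in> set ?p. (w k, x) \<in> parcs (cycle n)} = {w (k - 1)}"
    using k by (auto simp: set finish)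
  ultimately show ?thesis
    unfolding toll_walk_def using k nth[of 1] nth[of "k - 1"] by (simp add: hd last len)
qed

lemma translate_0: "u < n \<Longrightarrow> translate n u 0 = u"
  by (simp add: translate_def)

lemma arc_walk_ends:
  assumes "u < n"
  shows "hd (arc_walk n u \<sigma> k) = u" "last (arc_walk n u \<sigma> k) = translate n u (\<sigma> * int k)"
  using assms by (simp_all add: arc_walk_def translate_0 hd_map last_map del: upt_Suc)

text \<open>Each of the two arcs from \<open>u\<close> to \<open>v\<close> has an interior vertex,
  which the other arc misses. So both arcs are toll walks, and together they cover the
  cycle.\<close>

lemma toll_transit_cycle_nonadjacent:
  assumes uv: "u < n" "v < n" "u \<noteq> v" and nadj: "(u, v) \<notin> parcs (cycle n)"
  shows "toll_transit (cycle n) u v = {..<n}"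
proof -
  have n: "0 < n" using uv by simp
  have walk: "y \<in> toll_transit (cycle n) u v"
    if "\<sigma> \<in> {1, -1}" "1 \<le> k" "k + 2 \<le> n" "v = translate n u (\<sigma> * int k)" "j \<le> k"
      "y = translate n u (\<sigma> * int j)" for \<sigma> k j y
  proof -
    have "y \<in> set (arc_walk n u \<sigma> k)"
      using that by (auto simp: arc_walk_def simp del: upt_Suc)
    then show ?thesis
      using toll_walk_arc_walk[OF that(1-3), of u] arc_walk_ends[OF uv(1), of \<sigma> k] that(4) uv(3)
      unfolding toll_transit_def by auto
  qed
  \<comment> \<open>Going \<open>j\<close> steps forward or \<open>n - j\<close> steps backward
    leads to the same vertex.\<close>
  have pos: "\<exists>j<n. y = translate n u (int j) \<and> y = translate n u (int j - int n)" if "y < n" for y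
  proof -
    let ?j = "nat ((int y - int u) mod int n)"
    have "?j < n" using n by (simp add: nat_less_iff)
    moreover have "int ?j = (int y - int u) mod int n" using n by simp
    then have "y = translate n u (int ?j)"
      using that by (simp add: translate_def mod_simps)
    moreover from this have "y = translate n u (int ?j - int n)"
      by (simp add: translate_def add_diff_eq)
    ultimately show ?thesis by blast
  qed
  obtain k where k: "k < n" "v = translate n u (int k)" "v = translate n u (int k - int n)"
    using pos uv by blast
  have "v \<noteq> translate n u 0" using uv by (simp add: translate_0)
  moreover have "v \<noteq> translate n u 1" "v \<noteq> translate n u (-1)"
    using uv nadj offset_iff_translate[OF uv(2), of u] offset_sym[of n u v]
    by (simp_all add: parcs_cycle_iff)
  moreover have "int k - int n = -1" if "k = n - 1" using that n by (simp add: of_nat_diff)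
  \<comment> \<open>This leaves \<open>2 \<le> k \<le> n - 2\<close>, so \<open>k\<close> and
    \<open>n - k\<close> are both admissible lengths in \<open>walk\<close>.\<close>
  ultimately have k2: "k \<noteq> 0" "k \<noteq> 1" "k \<noteq> n - 1"
    using k by (metis of_nat_0, metis of_nat_1, metis)
  have "y \<in> toll_transit (cycle n) u v" if y: "y < n" for y
  proof -
    obtain j where j: "j < n" "y = translate n u (int j)" "y = translate n u (int j - int n)"
      using pos[OF y] by blast
    show ?thesis
    proof (cases "j \<le> k")
      case True
      then show ?thesis using walk[of 1 k j y] k k2 j by simp
    next
      case False
      \<comment> \<open>Vertices beyond \<open>v\<close> lie on the backward arc,
        \<open>n - j\<close> of its \<open>n - k\<close> steps away from \<open>u\<close>.\<close>
      then show ?thesis using walk[of "-1" "n - k" "n - j" y] k k2 j by (simp add: of_nat_diff)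
    qed
  qed
  moreover have "toll_transit (cycle n) u v \<subseteq> {..<n}"
    using uv by (auto simp: toll_transit_def toll_walk_def vwalk_def)
  ultimately show ?thesis by blast
qed

text \<open>A Boolean combination of offsets \<open>0\<close>, \<open>1\<close> and
  \<open>-1\<close> that has the same form for all \<open>n\<close>; this is all the game needs to
  know about toll walks.\<close>

lemma W_structure_cycle_iff:
  assumes "2 \<le> n" "x < n" "y < n" "z < n"
  shows "(x, y, z) \<in> snd (W_structure (cycle n)) \<longleftrightarrow>
    (if offset n x z 0 then offset n y x 0
     else offset n x z 1 \<or> offset n x z (-1) \<longrightarrow> offset n y x 0 \<or> offset n y z 0)"
proof (cases "x = z")
  case True
  then show ?thesis
    using assms by (simp add: W_structure_def toll_transit_def offset_0_iff)
next
  case False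
  show ?thesis
  proof (cases "(x, z) \<in> parcs (cycle n)")
    case True
    with False show ?thesis
      using assms toll_transit_adjacent[OF pair_graph_cycle True]
      by (auto simp: W_structure_def offset_0_iff parcs_cycle_iff)
  next
    case nadj: False
    with False show ?thesis
      using assms toll_transit_cycle_nonadjacent[OF assms(2,4) False nadj]
      by (auto simp: W_structure_def offset_0_iff parcs_cycle_iff)
  qed
qed

section \<open>The Ehrenfeucht--Fraisse game\<close>

text \<open>Duplicator's invariant with \<open>r\<close> rounds left. Offsets beyond the radius
  \<open>2 ^ r\<close> may differ freely.\<close>

definition same_offsets ::
  "nat \<Rightarrow> nat \<Rightarrow> nat \<Rightarrow> (nat \<Rightarrow> nat) \<Rightarrow> nat \<Rightarrow> (nat \<Rightarrow> nat) \<Rightarrow> bool" where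
  "same_offsets r N n s m t \<longleftrightarrow>
     (\<forall>i<N. \<forall>j<N. \<forall>d. \<bar>d\<bar> \<le> 2 ^ r \<longrightarrow> (offset n (s i) (s j) d \<longleftrightarrow> offset m (t i) (t j) d))"

lemma same_offsets_sym: "same_offsets r N n s m t \<Longrightarrow> same_offsets r N m t n s"
  by (simp add: same_offsets_def)

text \<open>
  At most \<open>N * (2 ^ Suc r + 1)\<close> vertices lie at offset at most \<open>2 ^ r\<close> from one of \<open>N\<close> given
  vertices; the remaining summand keeps a vertex from having a small nonzero offset to itself.
\<close>

definition long :: "nat \<Rightarrow> nat \<Rightarrow> nat \<Rightarrow> bool" where
  "long N r n \<longleftrightarrow> N * (2 ^ Suc r + 1) + 2 ^ r + 1 < n"

lemma long_Suc: "long N (Suc r) n \<Longrightarrow> long N r n"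
  unfolding long_def by (erule le_less_trans[rotated]) (intro add_mono mult_mono, auto)

lemma exists_far_vertex:
  assumes "long N r m"
  shows "\<exists>b<m. \<forall>i<N. \<forall>d. \<bar>d\<bar> \<le> 2 ^ r \<longrightarrow> \<not> offset m b (t i) d"
proof -
  let ?D = "{- (2 ^ r) .. 2 ^ r :: int}"
  \<comment> \<open>Translates may coincide, so the count gives only an upper bound on the number of
    near vertices, which suffices.\<close>
  let ?F = "(\<lambda>(i, d). translate m (t i) d) ` ({..<N} \<times> ?D)"
  have "card ?F \<le> card ({..<N} \<times> ?D)" by (rule card_image_le) simp
  also have "\<dots> = N * (2 ^ Suc r + 1)"
    by (simp add: card_cartesian_product nat_add_distrib nat_mult_distrib nat_power_eq)
  also have "\<dots> < card {..<m}" using assms by (simp add: long_def)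
  finally have "\<not> {..<m} \<subseteq> ?F" using card_mono[of ?F "{..<m}"] by fastforce
  then obtain b where b: "b < m" "b \<notin> ?F" by blast
  have "\<not> offset m b (t i) d" if "i < N" "\<bar>d\<bar> \<le> 2 ^ r" for i d
  proof
    assume "offset m b (t i) d"
    then have "b = translate m (t i) d" using b offset_iff_translate by blast
    moreover have "translate m (t i) d \<in> ?F"
      using that by (intro image_eqI[where x = "(i, d)"]) auto
    ultimately show False using b by simp
  qed
  with b show ?thesis by blast
qed

text \<open>A near move is copied with the same displacement \<open>d\<close> from the same index.
  An offset \<open>e\<close> to another old vertex then becomes an offset \<open>e - d\<close>
  between old vertices, of size at most \<open>2 ^ r + 2 ^ r\<close>; hence the radius halves in
  each round.\<close>

lemma same_offsets_response:
  assumes same: "same_offsets (Suc r) N n s m t" and long: "long N r m"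
  shows "\<exists>b<m. \<forall>i<N. \<forall>d. \<bar>d\<bar> \<le> 2 ^ r \<longrightarrow> (offset n a (s i) d \<longleftrightarrow> offset m b (t i) d)"
proof (cases "\<exists>i<N. \<exists>d. \<bar>d\<bar> \<le> 2 ^ r \<and> offset n a (s i) d")
  case True
  then obtain i d where i: "i < N" "\<bar>d\<bar> \<le> 2 ^ r" "offset n a (s i) d" by blast
  let ?b = "translate m (t i) d"
  have b: "?b < m" using long by (intro translate_less) (simp add: long_def)
  then have bi: "offset m ?b (t i) d" using offset_iff_translate by blast
  have "offset n a (s j) e \<longleftrightarrow> offset m ?b (t j) e" if "j < N" "\<bar>e\<bar> \<le> 2 ^ r" for j e
  proof -
    have "\<bar>e - d\<bar> \<le> 2 ^ Suc r" using that i by simp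
    then show ?thesis
      using same i(1) that(1) by (simp add: offset_shift[OF i(3)] offset_shift[OF bi] same_offsets_def)
  qed
  with b show ?thesis by blast
next
  case False
  \<comment> \<open>Neither new vertex has a small offset to an old one, so both sides of every
    equivalence are false.\<close>
  then show ?thesis using exists_far_vertex[OF long, of t] by blast
qed

lemma same_offsets_extend:
  assumes same: "same_offsets (Suc r) N n s m t" and long: "long N r n" "long N r m"
  shows "\<exists>b<m. same_offsets r N n (s(x := a)) m (t(x := b))"
proof -
  obtain b where b: "b < m"
    and near: "\<And>i d. i < N \<Longrightarrow> \<bar>d\<bar> \<le> 2 ^ r \<Longrightarrow> offset n a (s i) d \<longleftrightarrow> offset m b (t i) d"
    using same_offsets_response[OF same long(2)] by blast
  \<comment> \<open>The radius is below both lengths, so in either cycle the only small offset of a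
    vertex to itself is \<open>0\<close>.\<close>
  have "2 ^ r < int n" "2 ^ r < int m"
    using long unfolding long_def by (simp_all flip: of_nat_power_less_of_nat_cancel_iff of_nat_less_iff)
  then have self: "offset n a a d \<longleftrightarrow> offset m b b d" if "\<bar>d\<bar> \<le> 2 ^ r" for d
    using that offset_self_iff[of d n a] offset_self_iff[of d m b] by linarith
  have near': "offset n (s i) a d \<longleftrightarrow> offset m (t i) b d" if "i < N" "\<bar>d\<bar> \<le> 2 ^ r" for i d
    using near[of i "- d"] that by (simp add: offset_sym[of _ "s i"] offset_sym[of _ "t i"])
  have old: "offset n (s i) (s j) d \<longleftrightarrow> offset m (t i) (t j) d"
    if "i < N" "j < N" "\<bar>d\<bar> \<le> 2 ^ r" for i j d
  proof -
    have "\<bar>d\<bar> \<le> 2 ^ Suc r" using that(3) by simp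
    then show ?thesis using same that unfolding same_offsets_def by blast
  qed
  have "same_offsets r N n (s(x := a)) m (t(x := b))"
    using self near near' old by (simp add: same_offsets_def)
  with b show ?thesis by blast
qed

section \<open>Transfer of the game invariant to formulas\<close>

lemma fst_W_structure_cycle [simp]: "fst (W_structure (cycle n)) = {..<n}"
  by (simp add: W_structure_def)

text \<open>Induction with varying \<open>r\<close>, \<open>s\<close> and \<open>t\<close>: a
  quantifier costs one round, while \<open>N\<close> and the two cycles stay fixed.\<close>

lemma sat_cycle_iff:
  assumes "quantifier_rank \<phi> \<le> r" "width \<phi> \<le> N" "long N r n" "long N r m"
    and "\<And>i. s i < n" "\<And>i. t i < m" "same_offsets r N n s m t"
  shows "sat (W_structure (cycle n)) s \<phi> \<longleftrightarrow> sat (W_structure (cycle m)) t \<phi>"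
  using assms
proof (induction \<phi> arbitrary: r s t)
  case (Eq i j)
  then have "offset n (s i) (s j) 0 \<longleftrightarrow> offset m (t i) (t j) 0"
    by (simp add: same_offsets_def)
  then show ?case using Eq by (simp add: offset_0_iff)
next
  case (Rel i j k)
  \<comment> \<open>Even with no rounds left the radius is at least 1, which covers the offsets that
    an atom depends on.\<close>
  have "(1 :: int) \<le> 2 ^ r" by simp
  then have "offset n (s a) (s b) d \<longleftrightarrow> offset m (t a) (t b) d"
    if "a \<in> {i, j, k}" "b \<in> {i, j, k}" "d \<in> {0, 1, -1}" for a b d
    using Rel.prems(2,7) that by (auto simp: same_offsets_def)
  moreover have "2 \<le> n" "2 \<le> m"
    using Rel.prems(2,3,4) by (auto simp: long_def)
  ultimately show ?case using Rel.prems(5,6) by (simp add: W_structure_cycle_iff)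
next
  case (Neg \<phi>)
  then show ?case by simp
next
  case (Conj \<phi> \<psi>)
  then show ?case using Conj.IH[of r s t] by simp
next
  case (Exists x \<phi>)
  obtain r' where r: "r = Suc r'" using Exists.prems(1) by (cases r) auto
  have long: "long N r' n" "long N r' m" using Exists.prems(3,4) r long_Suc by auto
  have IH: "sat (W_structure (cycle n)) (s(x := a)) \<phi> \<longleftrightarrow>
      sat (W_structure (cycle m)) (t(x := b)) \<phi>"
    if "a < n" "b < m" "same_offsets r' N n (s(x := a)) m (t(x := b))" for a b
  proof -
    have "quantifier_rank \<phi> \<le> r'" "width \<phi> \<le> N" using Exists.prems(1,2) r by simp_all
    then show ?thesis
      using Exists.prems(5,6) that by (intro Exists.IH[OF _ _ long _ _ that(3)]) simp_all
  qed
  have same: "same_offsets (Suc r') N n s m t" using Exists.prems(7) r by simp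
  have "\<exists>b<m. sat (W_structure (cycle m)) (t(x := b)) \<phi>"
    if a: "a < n" "sat (W_structure (cycle n)) (s(x := a)) \<phi>" for a
  proof -
    obtain b where b: "b < m" "same_offsets r' N n (s(x := a)) m (t(x := b))"
      using same_offsets_extend[OF same long] by blast
    then show ?thesis using IH[OF a(1) b] a(2) by blast
  qed
  \<comment> \<open>The invariant is symmetric, so Spoiler's moves in the other cycle are answered
    by the same lemma with the cycles exchanged.\<close>
  moreover have "\<exists>a<n. sat (W_structure (cycle n)) (s(x := a)) \<phi>"
    if b: "b < m" "sat (W_structure (cycle m)) (t(x := b)) \<phi>" for b
  proof -
    obtain a where a: "a < n" "same_offsets r' N m (t(x := b)) n (s(x := a))"
      using same_offsets_extend[OF same_offsets_sym[OF same] long(2,1)] by blast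
    then show ?thesis using IH[OF a(1) b(1) same_offsets_sym[OF a(2)]] b(2) by blast
  qed
  ultimately show ?case by auto
qed

section \<open>Contradiction from two consecutive cycle lengths\<close>

theorem theorem19:
  shows "\<not> (\<exists>\<phi>. is_sentence \<phi> \<and>
    (\<forall>G :: nat pair_pre_digraph. pair_graph G \<and> connected (with_proj G) \<longrightarrow>
       (W_structure G \<Turnstile> \<phi> \<longleftrightarrow> bipartite G)))"
proof
  assume "\<exists>\<phi>. is_sentence \<phi> \<and>
    (\<forall>G :: nat pair_pre_digraph. pair_graph G \<and> connected (with_proj G) \<longrightarrow>
       (W_structure G \<Turnstile> \<phi> \<longleftrightarrow> bipartite G))"
  then obtain \<phi> where \<phi>: "is_sentence \<phi>"
    and defines_bipartite: "\<And>G :: nat pair_pre_digraph. pair_graph G \<Longrightarrow>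
      connected (with_proj G) \<Longrightarrow> W_structure G \<Turnstile> \<phi> \<longleftrightarrow> bipartite G"
    by blast
  define N where "N = width \<phi>"
  define r where "r = quantifier_rank \<phi>"
  \<comment> \<open>Doubling makes \<open>n\<close> even and larger than the bound in
    \<open>long\<close>; \<open>Suc n\<close> is then odd and long as well.\<close>
  define n where "n = 2 * (N * (2 ^ Suc r + 1) + 2 ^ r + 1)"
  \<comment> \<open>The constant assignment is admissible in both cycles and reduces the initial
    invariant to the offsets of \<open>0\<close> to itself.\<close>
  let ?s = "\<lambda>_ :: nat. 0 :: nat"
  have long: "long N r n" "long N r (Suc n)" by (simp_all add: long_def n_def)
  then have n: "2 \<le> n" by (simp add: n_def)
  have big: "2 ^ r < int n"
    using long(1) unfolding long_def
    by (simp flip: of_nat_power_less_of_nat_cancel_iff of_nat_less_iff)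
  have "offset n 0 0 d \<longleftrightarrow> offset (Suc n) 0 0 d" if "\<bar>d\<bar> \<le> 2 ^ r" for d
    using that big offset_self_iff[of d n 0] offset_self_iff[of d "Suc n" 0] by linarith
  then have "same_offsets r N n ?s (Suc n) ?s"
    by (simp add: same_offsets_def)
  then have "sat (W_structure (cycle n)) ?s \<phi> \<longleftrightarrow> sat (W_structure (cycle (Suc n))) ?s \<phi>"
    using n long by (intro sat_cycle_iff[of _ r N]) (simp_all add: N_def r_def)
  then have "W_structure (cycle n) \<Turnstile> \<phi> \<longleftrightarrow> W_structure (cycle (Suc n)) \<Turnstile> \<phi>"
    using n satisfies_sentence_iff[OF \<phi>, of ?s] by auto
  moreover have "W_structure (cycle n) \<Turnstile> \<phi>"
    using n defines_bipartite pair_graph_cycle connected_cycle bipartite_cycle by (simp add: n_def)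
  moreover have "\<not> W_structure (cycle (Suc n)) \<Turnstile> \<phi>"
    using n defines_bipartite pair_graph_cycle connected_cycle not_bipartite_cycle
    by (simp add: n_def)
  ultimately show False by blast
qed

end
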